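(* Let $X$ be a compact connected metric space with more than one point and let $f:X\to X$ be a distal homeomorphism. Then $f$ has no shadowable points.
   Context: Let $f:X\to X$ be a homeomorphism of a metric space $(X,d)$. For $\delta>0$, a bi-infinite sequence $\xi=(\xi_n)_{n\in\mathbb{Z}}$ of points of $X$ is a $\delta$-pseudo-orbit if $d(f(\xi_n),\xi_{n+1})\leq\delta$ for all $n\in\mathbb{Z}$. For $\epsilon>0$, $\xi$ can be $\epsilon$-shadowed if there is $x\in X$ such that $d(f^n(x),\xi_n)\leq\epsilon$ for all $n\in\mathbb{Z}$. A point $x\in X$ is shadowable if for every $\epsilon>0$ there is $\delta>0$ such that every $\delta$-pseudo-orbit $\xi$ with $\xi_0=x$ can be $\epsilon$-shadowed. The homeomorphism $f$ is distal if $\inf_{n\in\mathbb{Z}}d(f^n(x),f^n(y))>0$ for all distinct points $x,y\in X$. *)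

theory Defs
  imports "HOL-Analysis.Analysis"
begin

(* The space is a subset X of a metric type with the restricted metric; f is a self-homeomorphism
   of X, and its values outside X are irrelevant. Points, pseudo-orbits and shadowing points are
   therefore always required to lie in X. *)

(* f^n on X for n an integer; the value is meaningful at points of X when f is a bijection of X. *)
definition int_iterate :: "'a set \<Rightarrow> ('a \<Rightarrow> 'a) \<Rightarrow> int \<Rightarrow> 'a \<Rightarrow> 'a" where
  "int_iterate X f n = (if 0 \<le> n then f ^^ nat n else inv_into X f ^^ nat (- n))"

definition pseudo_orbit ::
  "'a::metric_space set \<Rightarrow> ('a \<Rightarrow> 'a) \<Rightarrow> real \<Rightarrow> (int \<Rightarrow> 'a) \<Rightarrow> bool" where
  "pseudo_orbit X f \<delta> \<xi> \<longleftrightarrow> (\<forall>n. \<xi> n \<in> X) \<and> (\<forall>n. dist (f (\<xi> n)) (\<xi> (n + 1)) \<le> \<delta>)"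

definition can_be_shadowed ::
  "'a::metric_space set \<Rightarrow> ('a \<Rightarrow> 'a) \<Rightarrow> real \<Rightarrow> (int \<Rightarrow> 'a) \<Rightarrow> bool" where
  "can_be_shadowed X f \<epsilon> \<xi> \<longleftrightarrow> (\<exists>x\<in>X. \<forall>n. dist (int_iterate X f n x) (\<xi> n) \<le> \<epsilon>)"

definition shadowable_point :: "'a::metric_space set \<Rightarrow> ('a \<Rightarrow> 'a) \<Rightarrow> 'a \<Rightarrow> bool" where
  "shadowable_point X f x \<longleftrightarrow> x \<in> X \<and>
     (\<forall>\<epsilon>>0. \<exists>\<delta>>0. \<forall>\<xi>. pseudo_orbit X f \<delta> \<xi> \<and> \<xi> 0 = x \<longrightarrow> can_be_shadowed X f \<epsilon> \<xi>)"

definition distal :: "'a::metric_space set \<Rightarrow> ('a \<Rightarrow> 'a) \<Rightarrow> bool" where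
  "distal X f \<longleftrightarrow> (\<forall>x\<in>X. \<forall>y\<in>X. x \<noteq> y \<longrightarrow>
     (INF n. dist (int_iterate X f n x) (int_iterate X f n y)) > 0)"

end

theory Submission
  imports Defs
begin

text \<open>
  A distal homeomorphism moves every point recurrently, and a recurrent orbit that starts near
  \<open>x\<close> cannot be driven away for good. Shadowing a suitable pseudo-orbit would do just that.

  The dynamical input is joint recurrence, lemma \<open>forward_distal_jointly_recurrent\<close>: for every
  finite set of points there is a single \<open>N > 0\<close> such that \<open>f\<^sup>N\<close> brings each of them back close to
  itself. It comes from Ellis's enveloping semigroup. The closure of \<open>{f, f\<^sup>2, \<dots>}\<close> in the
  topology of pointwise convergence is a compact semigroup of self-maps of \<open>X\<close>, so it contains an
  idempotent \<open>u\<close> (lemma \<open>ellis_numakura\<close>). As \<open>u x\<close> and \<open>x\<close> have the same image under \<open>u\<close>, some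
  iterates \<open>f\<^sup>n\<close> bring these two points arbitrarily close together; distality forces \<open>u x = x\<close>.
  Hence the identity is a pointwise limit of positive iterates.

  Now let \<open>x\<close> be shadowable and let \<open>y \<noteq> x\<close>. Connectedness gives a chain \<open>c\<^sub>0 = x, \<dots>, c\<^sub>k = y\<close>
  with short steps, and joint recurrence gives an \<open>N\<close> with \<open>f\<^sup>N(c\<^sub>i)\<close> close to \<open>c\<^sub>i\<close> for all \<open>i\<close>.
  Running through the first \<open>N\<close> points of the orbits of \<open>c\<^sub>0, c\<^sub>1, \<dots>, c\<^sub>k, c\<^sub>k, \<dots>\<close> one after the
  other is a pseudo-orbit (lemma \<open>pseudo_orbit_concat_blocks\<close>). A point \<open>z\<close> that shadows it lies
  near \<open>x\<close>, while \<open>f\<^sup>N\<^sup>t(z)\<close> lies near \<open>y\<close> for all \<open>t \<ge> k\<close>. But \<open>z\<close> is recurrent for the power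
  \<open>f\<^sup>m\<close> with \<open>m = N(k + 1)\<close>, which again is distal, so some such \<open>f\<^sup>N\<^sup>t(z)\<close> is close to \<open>z\<close>.
  If all errors are small compared with the distance of \<open>x\<close> and \<open>y\<close>, this is a contradiction.
\<close>

section \<open>Idempotents in compact right-topological semigroups\<close>

text \<open>
  Hausdorffness is expressed through \<^const>\<open>Hausdorff_space\<close>, here and below, and not through the
  class \<^class>\<open>t2_space\<close>: these results are applied to a function space, and an instance of that class
  for function types would clash with the one that makes functions on a countable domain a metric
  space.
\<close>

lemma compact_imp_closed_Hausdorff:
  fixes K :: "'b::topological_space set"
  assumes "Hausdorff_space (euclidean :: 'b topology)" "compact K"
  shows "closed K"
  using compactin_imp_closedin[OF assms(1), of K] assms(2) by simp

text \<open>
  The Ellis--Numakura lemma. Take a minimal compact subsemigroup \<open>M\<close> and \<open>u \<in> M\<close>. The left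
  ideal \<open>M u\<close> is again a compact subsemigroup, so it is all of \<open>M\<close> and \<open>p u = u\<close> has a solution
  in \<open>M\<close>. The solutions form a compact subsemigroup, too, so \<open>u\<close> itself is one of them.
\<close>

lemma ellis_numakura:
  fixes mul :: "'b::topological_space \<Rightarrow> 'b \<Rightarrow> 'b"
  assumes Hausdorff: "Hausdorff_space (euclidean :: 'b topology)"
    and "compact S" "S \<noteq> {}"
    and closed_mul: "\<And>p q. p \<in> S \<Longrightarrow> q \<in> S \<Longrightarrow> mul p q \<in> S"
    and assoc: "\<And>p q r. p \<in> S \<Longrightarrow> q \<in> S \<Longrightarrow> r \<in> S \<Longrightarrow> mul (mul p q) r = mul p (mul q r)"
    and cont: "\<And>q. q \<in> S \<Longrightarrow> continuous_on S (\<lambda>p. mul p q)"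
  shows "\<exists>u\<in>S. mul u u = u"
proof -
  define \<A> where
    "\<A> = {K. K \<subseteq> S \<and> closed K \<and> K \<noteq> {} \<and> (\<forall>p\<in>K. \<forall>q\<in>K. mul p q \<in> K)}"
  have subsemigroupI: "K \<in> \<A>"
    if "K \<subseteq> S" "closed K" "K \<noteq> {}" "\<And>p q. p \<in> K \<Longrightarrow> q \<in> K \<Longrightarrow> mul p q \<in> K" for K
    using that by (simp add: \<A>_def)
  have compact_mem: "compact K" if "K \<in> \<A>" for K
    using that compact_Int_closed[OF \<open>compact S\<close>, of K] by (auto simp: \<A>_def Int_absorb1)
  have "S \<in> \<A>"
    using assms compact_imp_closed_Hausdorff[OF Hausdorff] by (auto simp: \<A>_def)
  have "\<exists>M\<in>\<A>. \<forall>K\<in>\<A>. K \<subseteq> M \<longrightarrow> K = M"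
  proof (rule predicate_Zorn)
    show "partial_order_on \<A> (relation_of (\<lambda>K L. L \<subseteq> K) \<A>)"
      by (rule partial_order_on_relation_ofI) auto
  next
    fix C assume "C \<in> Chains (relation_of (\<lambda>K L. L \<subseteq> K) \<A>)"
    then have C: "C \<subseteq> \<A>" and chain: "\<And>K L. K \<in> C \<Longrightarrow> L \<in> C \<Longrightarrow> K \<subseteq> L \<or> L \<subseteq> K"
      by (auto simp: Chains_def relation_of_def)
    have mem_C: "closed K \<and> K \<subseteq> S \<and> K \<noteq> {} \<and> (\<forall>p\<in>K. \<forall>q\<in>K. mul p q \<in> K)" if "K \<in> C" for K
      using C that unfolding \<A>_def by blast
    \<comment> \<open>The set \<open>S\<close> is added to the chain as a lower bound of its empty subfamily.\<close>
    have lower: "\<exists>K\<in>insert S C. K \<subseteq> S \<inter> \<Inter>D" if "finite D" "D \<subseteq> C" for D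
      using that
    proof (induction D)
      case (insert L D)
      then obtain K where K: "K \<in> insert S C" "K \<subseteq> S \<inter> \<Inter>D"
        by blast
      have "L \<in> C" "L \<subseteq> S"
        using insert mem_C by auto
      then have "K \<subseteq> L \<or> L \<subseteq> K"
        using K chain by blast
      then show ?case
      proof
        assume "K \<subseteq> L"
        then have "K \<subseteq> S \<inter> \<Inter>(insert L D)"
          using K(2) by auto
        then show ?thesis
          using K(1) by (rule bexI)
      next
        assume "L \<subseteq> K"
        then have "L \<subseteq> S \<inter> \<Inter>(insert L D)"
          using K(2) \<open>L \<subseteq> S\<close> by auto
        then show ?thesis
          using insertI2[OF \<open>L \<in> C\<close>] by (rule bexI)
      qed
    qed simp
    have "S \<inter> \<Inter>C \<noteq> {}"
    proof (rule compact_imp_fip[OF \<open>compact S\<close>])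
      fix D assume "finite D" "D \<subseteq> C"
      then obtain K where K: "K \<in> insert S C" "K \<subseteq> S \<inter> \<Inter>D"
        by (rule lower[THEN bexE])
      have "K \<noteq> {}"
        using K(1) mem_C \<open>S \<noteq> {}\<close> by blast
      then show "S \<inter> \<Inter>D \<noteq> {}"
        using K(2) by (metis subset_empty)
    qed (use mem_C in blast)
    moreover have "closed (S \<inter> \<Inter>C)"
      using mem_C \<open>S \<in> \<A>\<close> by (intro closed_Int closed_Inter) (auto simp: \<A>_def)
    moreover have "mul p q \<in> S \<inter> \<Inter>C" if "p \<in> S \<inter> \<Inter>C" "q \<in> S \<inter> \<Inter>C" for p q
    proof (intro IntI InterI)
      show "mul p q \<in> K" if "K \<in> C" for K
        using mem_C[OF that] \<open>p \<in> S \<inter> \<Inter>C\<close> \<open>q \<in> S \<inter> \<Inter>C\<close> that by (meson IntD2 InterE)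
    qed (use that closed_mul in auto)
    ultimately have "S \<inter> \<Inter>C \<in> \<A>"
      by (intro subsemigroupI) simp_all
    then show "\<exists>K\<in>\<A>. \<forall>L\<in>C. K \<subseteq> L"
      by (rule bexI[rotated]) blast
  qed
  then obtain M where "M \<in> \<A>" and minimal: "\<And>K. K \<in> \<A> \<Longrightarrow> K \<subseteq> M \<Longrightarrow> K = M"
    by blast
  then have "M \<subseteq> S" "closed M" "M \<noteq> {}"
    and mul_M: "\<And>p q. p \<in> M \<Longrightarrow> q \<in> M \<Longrightarrow> mul p q \<in> M"
    by (auto simp: \<A>_def)
  have assoc_M: "mul (mul p q) r = mul p (mul q r)" if "p \<in> M" "q \<in> M" "r \<in> M" for p q r
    using that assoc \<open>M \<subseteq> S\<close> by blast
  from \<open>M \<noteq> {}\<close> obtain u where "u \<in> M"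
    by blast
  have cont_u: "continuous_on M (\<lambda>p. mul p u)"
    using cont \<open>u \<in> M\<close> \<open>M \<subseteq> S\<close> continuous_on_subset by blast
  have "(\<lambda>p. mul p u) ` M = M"
  proof (rule minimal)
    have "closed ((\<lambda>p. mul p u) ` M)"
      using cont_u compact_mem[OF \<open>M \<in> \<A>\<close>]
      by (intro compact_imp_closed_Hausdorff[OF Hausdorff] compact_continuous_image)
    moreover have "mul (mul p u) (mul q u) \<in> (\<lambda>p. mul p u) ` M" if "p \<in> M" "q \<in> M" for p q
    proof
      show "mul (mul p u) (mul q u) = mul (mul (mul p u) q) u"
        using that \<open>u \<in> M\<close> mul_M assoc_M by simp
    qed (use that \<open>u \<in> M\<close> mul_M in blast)
    moreover have "(\<lambda>p. mul p u) ` M \<subseteq> S"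
      using mul_M \<open>u \<in> M\<close> \<open>M \<subseteq> S\<close> by blast
    ultimately show "(\<lambda>p. mul p u) ` M \<in> \<A>"
      using \<open>M \<noteq> {}\<close> by (intro subsemigroupI) auto
  qed (use mul_M \<open>u \<in> M\<close> in blast)
  then obtain p where "p \<in> M" "mul p u = u"
    using \<open>u \<in> M\<close> by (metis imageE)
  have "{p \<in> M. mul p u = u} = M"
  proof (rule minimal)
    have "closed {p \<in> M. mul p u = u}"
      using continuous_closed_preimage[OF cont_u \<open>closed M\<close>, of "{u}"]
        compact_imp_closed_Hausdorff[OF Hausdorff, of "{u}"]
      by (simp add: vimage_def Int_def)
    then show "{p \<in> M. mul p u = u} \<in> \<A>"
      using \<open>M \<subseteq> S\<close> \<open>p \<in> M\<close> \<open>mul p u = u\<close> \<open>u \<in> M\<close> mul_M assoc_M by (auto simp: \<A>_def)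
  qed blast
  then have "mul u u = u"
    using \<open>u \<in> M\<close> by blast
  then show ?thesis
    using \<open>u \<in> M\<close> \<open>M \<subseteq> S\<close> by blast
qed

section \<open>Joint recurrence of finitely many points\<close>

lemma Hausdorff_space_fun: "Hausdorff_space (euclidean :: ('i \<Rightarrow> 'b::metric_space) topology)"
  unfolding euclidean_product_topology[symmetric] Hausdorff_space_product_topology by simp

lemma compact_pointwise_product:
  fixes B :: "'i \<Rightarrow> 'b::topological_space set"
  assumes "\<And>i. compact (B i)"
  shows "compact {p. \<forall>i. p i \<in> B i}"
proof -
  have "compactin (product_topology (\<lambda>i. euclidean) UNIV) (PiE UNIV B)"
    using assms by (simp add: compactin_PiE)
  then show ?thesis
    by (simp add: euclidean_product_topology PiE_def Pi_def)
qed

lemma funpow_mem: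
  assumes "h \<in> X \<rightarrow> X" "x \<in> X"
  shows "(h ^^ n) x \<in> X"
  using assms by (induction n) auto

lemma continuous_on_funpow:
  assumes "continuous_on X h" "h \<in> X \<rightarrow> X"
  shows "continuous_on X (h ^^ n)"
proof (induction n)
  case (Suc n)
  have "continuous_on ((h ^^ n) ` X) h"
    using funpow_mem[OF assms(2)] by (intro continuous_on_subset[OF assms(1)]) blast
  then show ?case
    using continuous_on_compose[OF Suc] by (simp add: o_def)
qed simp

text \<open>
  The idempotent obtained from \<open>ellis_numakura\<close> is a pointwise limit of positive iterates of \<open>h\<close>
  and fixes every point, since \<open>x\<close> and \<open>u x\<close> would otherwise contradict distality.
  Membership in a closure for pointwise convergence only speaks of finitely many points at a time,
  but of those simultaneously; this is why one \<open>n\<close> serves all of \<open>F\<close>.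
\<close>

lemma forward_distal_jointly_recurrent:
  fixes h :: "'a::metric_space \<Rightarrow> 'a"
  assumes "compact X" "continuous_on X h" and maps: "h \<in> X \<rightarrow> X"
    and forward_distal: "\<And>x y. x \<in> X \<Longrightarrow> y \<in> X \<Longrightarrow> x \<noteq> y \<Longrightarrow>
          \<exists>c>0. \<forall>n. c \<le> dist ((h ^^ n) x) ((h ^^ n) y)"
    and "finite F" "F \<subseteq> X" "0 < \<delta>"
  shows "\<exists>n>0. \<forall>x\<in>F. dist ((h ^^ n) x) x < \<delta>"
proof -
  \<comment> \<open>Total maps that preserve \<open>X\<close> and fix every point outside it represent the self-maps of
    \<open>X\<close>. They are closed under composition and, by Tychonoff's theorem, compact.\<close>
  define g where "g x = (if x \<in> X then h x else x)" for x
  define B where "B x = (if x \<in> X then X else {x})" for x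
  define E where "E = {p. \<forall>x. p x \<in> B x}"
  define P where "P = range (\<lambda>n. g ^^ Suc n)"
  define S where "S = closure P"
  have g_in: "(g ^^ n) x = (h ^^ n) x" if "x \<in> X" for n x
    by (induction n) (use that maps in \<open>auto simp: g_def funpow_mem\<close>)
  have g_out: "(g ^^ n) x = x" if "x \<notin> X" for n x
    by (induction n) (use that in \<open>auto simp: g_def\<close>)
  have g_E: "g ^^ n \<in> E" for n
    using g_in g_out funpow_mem[OF maps] by (auto simp: E_def B_def)
  have "compact E"
    unfolding E_def by (rule compact_pointwise_product) (auto simp: B_def \<open>compact X\<close>)
  then have "S \<subseteq> E"
    unfolding S_def P_def by (intro closure_minimal compact_imp_closed_Hausdorff[OF Hausdorff_space_fun]) (use g_E in blast)+
  have "closed S"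
    by (simp add: S_def)
  have "compact S"
    using compact_Int_closed[OF \<open>compact E\<close> \<open>closed S\<close>] \<open>S \<subseteq> E\<close> by (simp add: Int_absorb1)
  have "P \<subseteq> S"
    by (simp add: S_def closure_subset)
  have S_B: "p x \<in> B x" if "p \<in> S" for p x
    using that \<open>S \<subseteq> E\<close> unfolding E_def by blast
  have S_X: "p x \<in> X" if "p \<in> S" "x \<in> X" for p x
    using S_B[of p x] that by (simp add: B_def)
  have S_out: "p x = x" if "p \<in> S" "x \<notin> X" for p x
    using S_B[of p x] that by (simp add: B_def)
  have cont_right: "continuous_on A (\<lambda>p. p \<circ> q)" for q :: "'a \<Rightarrow> 'a" and A :: "('a \<Rightarrow> 'a) set"
    by (intro continuous_on_coordinatewise_then_product)
      (simp add: continuous_on_subset[OF continuous_on_product_coordinates])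
  have cont_left: "continuous_on S (\<lambda>q. g ^^ n \<circ> q)" for n
  proof (rule continuous_on_coordinatewise_then_product)
    fix x
    have coord: "continuous_on S (\<lambda>q. q x)"
      by (rule continuous_on_subset[OF continuous_on_product_coordinates]) simp
    show "continuous_on S (\<lambda>q. (g ^^ n \<circ> q) x)"
    proof (cases "x \<in> X")
      case True
      have "continuous_on S (\<lambda>q. (h ^^ n) (q x))"
        using S_X True
        by (intro continuous_on_compose2[OF continuous_on_funpow[OF assms(2,3)] coord]) auto
      then show ?thesis
        by (rule continuous_on_eq) (use S_X True g_in in auto)
    next
      case False
      have "(g ^^ n \<circ> q) x = x" if "q \<in> S" for q
        using S_out[OF that False] g_out[OF False] by simp
      then show ?thesis
        by (simp cong: continuous_on_cong)
    qed
  qed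
  \<comment> \<open>Closure under composition is obtained one factor at a time. Composition is continuous in its
    right factor only if the left one is, so the left factor is an iterate of \<open>g\<close> at first;
    in its left factor composition is always continuous.\<close>
  have P_S: "p \<circ> q \<in> S" if p: "p \<in> P" and q: "q \<in> S" for p q
  proof -
    obtain n where n: "p = g ^^ Suc n"
      using p by (auto simp: P_def)
    have "(\<lambda>q. g ^^ Suc n \<circ> q) ` P \<subseteq> P"
    proof
      fix r assume "r \<in> (\<lambda>q. g ^^ Suc n \<circ> q) ` P"
      then obtain m where "r = g ^^ Suc n \<circ> g ^^ Suc m"
        by (auto simp: P_def)
      then have "r = g ^^ Suc (Suc (n + m))"
        by (metis funpow_add add_Suc add_Suc_right)
      then show "r \<in> P"
        unfolding P_def by blast
    qed
    then have "(\<lambda>q. g ^^ Suc n \<circ> q) ` closure P \<subseteq> S"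
      using cont_left[of "Suc n"] \<open>closed S\<close> \<open>P \<subseteq> S\<close>
      by (intro image_closure_subset) (auto simp: S_def)
    then show ?thesis
      using q n by (auto simp: S_def)
  qed
  have "p \<circ> q \<in> S" if "p \<in> S" "q \<in> S" for p q
  proof -
    have "(\<lambda>p. p \<circ> q) ` closure P \<subseteq> S"
      using cont_right \<open>closed S\<close> P_S that by (intro image_closure_subset) auto
    then show ?thesis
      using that by (auto simp: S_def)
  qed
  moreover have "S \<noteq> {}"
    using \<open>P \<subseteq> S\<close> by (auto simp: P_def)
  ultimately have "\<exists>u\<in>S. u \<circ> u = u"
    using cont_right \<open>compact S\<close>
    by (intro ellis_numakura[OF Hausdorff_space_fun, where mul = "(\<circ>)"]) (simp_all add: comp_assoc)
  then obtain u where "u \<in> S" and idem: "u \<circ> u = u"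
    by blast
  have approx: "\<exists>n>0. \<forall>x\<in>G. dist ((h ^^ n) x) (u x) < \<eta>"
    if "finite G" "G \<subseteq> X" "0 < \<eta>" for G \<eta>
  proof -
    have "open (\<Inter>x\<in>G. (\<lambda>p :: 'a \<Rightarrow> 'a. p x) -` ball (u x) \<eta>)"
      using \<open>finite G\<close> by (intro open_INT ballI open_vimage) auto
    moreover have "u \<in> (\<Inter>x\<in>G. (\<lambda>p :: 'a \<Rightarrow> 'a. p x) -` ball (u x) \<eta>)"
      using \<open>0 < \<eta>\<close> by auto
    ultimately obtain p where "p \<in> P" "p \<in> (\<Inter>x\<in>G. (\<lambda>p. p x) -` ball (u x) \<eta>)"
      using \<open>u \<in> S\<close> unfolding S_def closure_iff_nhds_not_empty by blast
    then obtain n where "\<forall>x\<in>G. dist ((g ^^ Suc n) x) (u x) < \<eta>"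
      by (auto simp: P_def dist_commute)
    then have "\<forall>x\<in>G. dist ((h ^^ Suc n) x) (u x) < \<eta>"
      using g_in \<open>G \<subseteq> X\<close> by (metis subsetD)
    then show ?thesis
      by blast
  qed
  have "u x = x" if x: "x \<in> X" for x
  proof (rule ccontr)
    assume "u x \<noteq> x"
    then obtain c where c: "0 < c" "\<And>n. c \<le> dist ((h ^^ n) x) ((h ^^ n) (u x))"
      using forward_distal[of x "u x"] S_X[OF \<open>u \<in> S\<close> x] x by metis
    obtain n where n: "\<forall>y\<in>{x, u x}. dist ((h ^^ n) y) (u y) < c / 2"
      using approx[of "{x, u x}" "c / 2"] S_X[OF \<open>u \<in> S\<close> x] x \<open>0 < c\<close> by auto
    have "u (u x) = u x"
      using fun_cong[OF idem, of x] by simp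
    then have "dist ((h ^^ n) x) (u x) < c / 2" "dist ((h ^^ n) (u x)) (u x) < c / 2"
      using n by simp_all
    then have "dist ((h ^^ n) x) ((h ^^ n) (u x)) < c"
      by (rule dist_triangle_half_l)
    then show False
      using c(2)[of n] by simp
  qed
  then show ?thesis
    using approx[OF assms(5,6,7)] \<open>F \<subseteq> X\<close> by (metis subsetD)
qed

section \<open>Pseudo-orbits along chains\<close>

text \<open>
  Points that can be joined by such a chain form an equivalence relation with open classes.
\<close>

lemma connected_chain_in_steps:
  fixes X :: "'a::metric_space set"
  assumes "connected X" "x \<in> X" "y \<in> X" "0 < \<delta>"
  shows "\<exists>c k. c 0 = x \<and> c k = y \<and> (\<forall>i\<le>k. c i \<in> X) \<and> (\<forall>i<k. dist (c i) (c (Suc i)) < \<delta>)"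
proof -
  define R where "R = {(a, b). a \<in> X \<and> b \<in> X \<and> dist a b < \<delta>}"
  have "sym R"
    by (auto simp: R_def sym_def dist_commute)
  have "(x, y) \<in> R\<^sup>*"
  proof (rule connected_equivalence_relation[OF \<open>connected X\<close> \<open>x \<in> X\<close> \<open>y \<in> X\<close>])
    fix a assume "a \<in> X"
    have "openin (top_of_set X) (X \<inter> ball a \<delta>)"
      by (simp add: openin_open_Int)
    moreover have "(a, b) \<in> R\<^sup>*" if "b \<in> X \<inter> ball a \<delta>" for b
      using that \<open>a \<in> X\<close> by (auto simp: R_def)
    ultimately show "\<exists>T. openin (top_of_set X) T \<and> a \<in> T \<and> (\<forall>b\<in>T. (a, b) \<in> R\<^sup>*)"
      using \<open>a \<in> X\<close> \<open>0 < \<delta>\<close> by (metis IntI centre_in_ball)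
  next
    show "(b, a) \<in> R\<^sup>*" if "(a, b) \<in> R\<^sup>*" for a b
      using that sym_rtrancl[OF \<open>sym R\<close>] by (meson symD)
  qed (rule rtrancl_trans)
  then obtain k c where c: "c 0 = x" "c k = y" "\<forall>i<k. (c i, c (Suc i)) \<in> R"
    by (auto simp: rtrancl_power relpow_fun_conv)
  have "c i \<in> X" if "i \<le> k" for i
  proof (cases "i < k")
    case False
    then show ?thesis using that c \<open>y \<in> X\<close> by simp
  qed (use c in \<open>auto simp: R_def\<close>)
  then show ?thesis
    using c by (auto simp: R_def intro!: exI[of _ c] exI[of _ k])
qed

text \<open>
  Block \<open>j\<close> of the sequence consists of the first \<open>N\<close> points of the orbit of \<open>c j\<close>. Inside a block
  the map is followed exactly, so errors occur only where the next block starts.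
\<close>

lemma pseudo_orbit_concat_blocks:
  assumes maps: "f \<in> X \<rightarrow> X" and "0 < N" and c_X: "\<And>j. c j \<in> X" and "0 \<le> \<delta>"
    and jump: "\<And>j. dist ((f ^^ N) (c j)) (c (j + 1)) \<le> \<delta>"
  shows "pseudo_orbit X f \<delta> (\<lambda>n. (f ^^ nat (n mod int N)) (c (n div int N)))"
  unfolding pseudo_orbit_def
proof (intro conjI allI)
  fix n :: int
  show "(f ^^ nat (n mod int N)) (c (n div int N)) \<in> X"
    using funpow_mem[OF maps c_X] .
  define r j where "r = n mod int N" and "j = n div int N"
  have r: "0 \<le> r" "r < int N" and n: "n = int N * j + r"
    using \<open>0 < N\<close> by (auto simp: r_def j_def)
  show "dist (f ((f ^^ nat (n mod int N)) (c (n div int N))))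
         ((f ^^ nat ((n + 1) mod int N)) (c ((n + 1) div int N))) \<le> \<delta>"
  proof (cases "r + 1 = int N")
    case True
    then have "n + 1 = int N * (j + 1)"
      using n by (simp add: algebra_simps)
    then have "(n + 1) mod int N = 0" "(n + 1) div int N = j + 1"
      using \<open>0 < N\<close> by auto
    moreover have "N = Suc (nat r)"
      using True r by linarith
    then have "f ((f ^^ nat r) (c j)) = (f ^^ N) (c j)"
      by simp
    ultimately show ?thesis
      using jump[of j] by (simp flip: r_def j_def)
  next
    case False
    have n1: "n + 1 = int N * j + (r + 1)"
      using n by simp
    have "(n + 1) mod int N = r + 1" "(n + 1) div int N = j"
      using r False int_mod_pos_eq[OF n1] int_div_pos_eq[OF n1] by linarith+
    moreover have "nat (r + 1) = Suc (nat r)"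
      using r by linarith
    ultimately show ?thesis
      using \<open>0 \<le> \<delta>\<close> by (simp flip: r_def j_def)
  qed
qed

section \<open>Distal homeomorphisms of continua\<close>

lemma distal_imp_forward_distal:
  assumes "distal X f" "x \<in> X" "y \<in> X" "x \<noteq> y"
  shows "\<exists>c>0. \<forall>n. c \<le> dist ((f ^^ n) x) ((f ^^ n) y)"
proof (intro exI conjI allI)
  show "0 < (INF n. dist (int_iterate X f n x) (int_iterate X f n y))"
    using assms by (auto simp: distal_def)
  fix n
  have "(INF n. dist (int_iterate X f n x) (int_iterate X f n y))
      \<le> dist (int_iterate X f (int n) x) (int_iterate X f (int n) y)"
    by (intro cINF_lower bdd_belowI[of _ 0]) auto
  then show "(INF n. dist (int_iterate X f n x) (int_iterate X f n y))
      \<le> dist ((f ^^ n) x) ((f ^^ n) y)"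
    by (simp add: int_iterate_def)
qed

theorem corollary1p6:
  fixes X :: "'a::metric_space set" and f :: "'a \<Rightarrow> 'a"
  assumes "compact X" and "connected X"
    and "\<exists>a\<in>X. \<exists>b\<in>X. a \<noteq> b"
    and "\<exists>g. homeomorphism X X f g"
    and "distal X f"
  shows "\<not> (\<exists>x. shadowable_point X f x)"
proof
  assume "\<exists>x. shadowable_point X f x"
  then obtain x where shadowable: "shadowable_point X f x"
    by blast
  then have "x \<in> X"
    by (simp add: shadowable_point_def)
  obtain y where "y \<in> X" "y \<noteq> x"
    using assms(3) by metis
  have cont: "continuous_on X f" and maps: "f \<in> X \<rightarrow> X"
    using assms(4) by (auto simp: homeomorphism_def)
  \<comment> \<open>Recurrence along the multiples of \<open>m\<close>: the power \<open>f\<^sup>m\<close> inherits forward distality.\<close>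
  have recurrent: "\<exists>n>0. \<forall>z\<in>F. dist ((f ^^ (m * n)) z) z < \<eta>"
    if "finite F" "F \<subseteq> X" "0 < \<eta>" for F \<eta> and m :: nat
  proof -
    have "\<exists>n>0. \<forall>z\<in>F. dist (((f ^^ m) ^^ n) z) z < \<eta>"
    proof (rule forward_distal_jointly_recurrent[OF assms(1) _ _ _ that])
      show "continuous_on X (f ^^ m)"
        by (rule continuous_on_funpow[OF cont maps])
      show "f ^^ m \<in> X \<rightarrow> X"
        using funpow_mem[OF maps] by blast
      show "\<exists>c>0. \<forall>n. c \<le> dist (((f ^^ m) ^^ n) a) (((f ^^ m) ^^ n) b)"
        if "a \<in> X" "b \<in> X" "a \<noteq> b" for a b
        using distal_imp_forward_distal[OF assms(5) that] by (metis funpow_mult)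
    qed
    then show ?thesis
      by (simp add: funpow_mult mult.commute)
  qed
  define \<epsilon> where "\<epsilon> = dist x y / 3"
  have "0 < \<epsilon>"
    using \<open>y \<noteq> x\<close> by (simp add: \<epsilon>_def)
  then obtain \<delta> where "0 < \<delta>" and \<delta>:
    "\<And>\<xi>. pseudo_orbit X f \<delta> \<xi> \<Longrightarrow> \<xi> 0 = x \<Longrightarrow> can_be_shadowed X f \<epsilon> \<xi>"
    using shadowable unfolding shadowable_point_def by blast
  obtain c k where c: "c 0 = x" "c k = y" "\<And>i. i \<le> k \<Longrightarrow> c i \<in> X"
    and step: "\<And>i. i < k \<Longrightarrow> dist (c i) (c (Suc i)) < \<delta> / 2"
    using connected_chain_in_steps[OF assms(2) \<open>x \<in> X\<close> \<open>y \<in> X\<close>, of "\<delta> / 2"] \<open>0 < \<delta>\<close>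
    by (metis half_gt_zero)
  obtain N where "0 < N" and N: "\<forall>z\<in>c ` {..k}. dist ((f ^^ N) z) z < \<delta> / 2"
    using recurrent[of "c ` {..k}" "\<delta> / 2" 1] c(3) \<open>0 < \<delta>\<close> by auto
  \<comment> \<open>The block starts rest at \<open>x\<close> before time \<open>0\<close>, as \<^const>\<open>nat\<close> sends negative numbers to \<open>0\<close>,
    and rest at \<open>y\<close> from block \<open>k\<close> on.\<close>
  define b where "b j = c (min k (nat j))" for j
  define \<xi> where "\<xi> n = (f ^^ nat (n mod int N)) (b (n div int N))" for n
  have "dist ((f ^^ N) (b j)) (b (j + 1)) \<le> \<delta>" for j
  proof -
    have "dist ((f ^^ N) (b j)) (b j) < \<delta> / 2"
      using N by (simp add: b_def)
    moreover have "dist (b j) (b (j + 1)) < \<delta> / 2"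
    proof (cases "0 \<le> j \<and> nat j < k")
      case True
      then have "min k (nat j) = nat j" "min k (nat (j + 1)) = Suc (nat j)"
        by auto
      then show ?thesis
        using step True by (simp add: b_def)
    next
      case False
      then have "min k (nat j) = min k (nat (j + 1))"
        by auto
      then show ?thesis
        using \<open>0 < \<delta>\<close> by (simp add: b_def)
    qed
    ultimately show ?thesis
      using dist_triangle[of "(f ^^ N) (b j)" "b (j + 1)" "b j"] by linarith
  qed
  then have "pseudo_orbit X f \<delta> \<xi>"
    unfolding \<xi>_def using maps \<open>0 < N\<close> \<open>0 < \<delta>\<close> c(3)
    by (intro pseudo_orbit_concat_blocks) (auto simp: b_def)
  moreover have "\<xi> 0 = x"
    by (simp add: \<xi>_def b_def c)
  ultimately obtain z where "z \<in> X" and z: "\<And>n. dist (int_iterate X f n z) (\<xi> n) \<le> \<epsilon>"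
    using \<delta> unfolding can_be_shadowed_def by blast
  have near_x: "dist z x \<le> \<epsilon>"
    using z[of 0] \<open>\<xi> 0 = x\<close> by (simp add: int_iterate_def)
  \<comment> \<open>The factor \<open>k + 1\<close> makes sure that the return happens when the pseudo-orbit has reached \<open>y\<close>,
    and the factor \<open>N\<close> that it happens at the start of a block.\<close>
  obtain n where "0 < n" and return: "dist ((f ^^ (N * Suc k * n)) z) z < \<epsilon>"
    using recurrent[of "{z}" \<epsilon> "N * Suc k"] \<open>z \<in> X\<close> \<open>0 < \<epsilon>\<close> by auto
  define t where "t = Suc k * n"
  have "k \<le> t"
    using \<open>0 < n\<close> by (cases n) (auto simp: t_def)
  have "\<xi> (int (N * t)) = y"
    using \<open>0 < N\<close> \<open>k \<le> t\<close> c by (simp add: \<xi>_def b_def)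
  then have near_y: "dist ((f ^^ (N * t)) z) y \<le> \<epsilon>"
    using z[of "int (N * t)"] by (simp add: int_iterate_def del: of_nat_mult)
  have "dist ((f ^^ (N * t)) z) z < \<epsilon>"
    using return unfolding t_def by (simp only: mult.assoc)
  with near_x near_y have "dist x y < 3 * \<epsilon>"
    using dist_triangle[of x y z] dist_triangle[of z y "(f ^^ (N * t)) z"]
    by (simp add: dist_commute)
  then show False
    by (simp add: \<epsilon>_def)
qed

end
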